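(* Let $1\le p<\infty$ with conjugate exponent $p'$. For every $n\in\mathbb N$ and every even $m\in\mathbb N$, $$\mathfrak R_p(n,m)=\mathfrak R_{p'}^*(n,m)=m.$$ If $n=1$, the same identity holds for every $m\in\mathbb N$. If $n\ge2$ and $m$ is odd, then $$\mathfrak R_p(n,m)=\mathfrak R_{p'}^*(n,m)=+\infty.$$
   Context: All spaces are real; $\mathbb N=\{1,2,\ldots\}$; $[n]=\{1,\ldots,n\}$; $p'$ is the conjugate exponent of $p$, with $p'=\infty$ when $p=1$. Let $G_{m,n}=(\mathbb Z/(2m\mathbb Z))^n$ and $\Sigma_n=\{-1,1\}^n$. Let $e_j$ be the $j$-th standard basis vector; additions in $G_{m,n}$ are modulo $2m$. For a finite nonempty set $\Omega$, a Banach space $Y$ and $1\le r<\infty$, $L_r(\Omega;Y)$ is the space of all maps $F:\Omega\to Y$ with $\|F\|_{L_r(\Omega;Y)}=\bigl(|\Omega|^{-1}\sum_{\omega\in\Omega}\|F(\omega)\|_Y^r\bigr)^{1/r}$; for $r=\infty$ the norm is the maximum of $\|F(\omega)\|_Y$. $L_r(\Omega)=L_r(\Omega;\mathbb R)$. For $f:G_{m,n}\to\mathbb R$ define $(D_{\mathrm{long}}f)(x,j)=f(x+me_j)-f(x)$ for $(x,j)\in G_{m,n}\times[n]$ and $(D_{\mathrm{sgn}}f)(x,\varepsilon)=f(x+\varepsilon)-f(x)$ for $(x,\varepsilon)\in G_{m,n}\times\Sigma_n$. Their adjoints (for the normalized finite-sum dualities) are, for $g:G_{m,n}\times[n]\to\mathbb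 R$ and $h:G_{m,n}\times\Sigma_n\to\mathbb R$, $$D_{\mathrm{long}}^*g(x)=\frac1n\sum_{j=1}^n\bigl(g(x-me_j,j)-g(x,j)\bigr),\qquad D_{\mathrm{sgn}}^*h(x)=2^{-n}\sum_{\varepsilon\in\Sigma_n}\bigl(h(x-\varepsilon,\varepsilon)-h(x,\varepsilon)\bigr).$$ For a linear operator $R:L_r(\Omega)\to L_r(\Omega')$ between such finite scalar spaces, $1\le r\le\infty$, its regular norm is $\|R\|_{\mathrm{reg}}=\sup_{N\ge1}\|R\otimes I_{\ell_\infty^N}\|$, where $R\otimes I_{\ell_\infty^N}:L_r(\Omega;\ell_\infty^N)\to L_r(\Omega';\ell_\infty^N)$ acts on vector-valued functions by the same scalar matrix as $R$ (i.e. coordinatewise), and the norm is the operator norm. Define $$\mathfrak R_p(n,m)=\inf\{\|T\|_{\mathrm{reg}}:TD_{\mathrm{sgn}}=D_{\mathrm{long}}\},\qquad \mathfrak R_{p'}^*(n,m)=\inf\{\|S\|_{\mathrm{reg}}:D_{\mathrm{sgn}}^*S=D_{\mathrm{long}}^*\},$$ where $T$ ranges over linear operators $L_p(G_{m,n}\times\Sigma_n)\to L_p(G_{m,n}\times[n])$ and $S$ over linear operators $L_{p'}(G_{m,n}\times[n])\to L_{p'}(G_{m,n}\times\Sigma_n)$; the infimum of an empty set is $+\infty$. *)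

theory Defs
  imports Complex_Main "HOL-Library.FuncSet" "HOL-Library.Extended_Real"
begin

text \<open>
  Maps on a finite set \<open>\<Omega>\<close> are extensional functions, that is, elements of
  \<open>\<Omega> \<rightarrow>\<^sub>E Y\<close>. The residue group \<open>\<int>/2m\<int>\<close> is represented by
  the integers in \<open>{0..<2m}\<close>, with addition modulo \<open>2m\<close>. Sign vectors are integer
  vectors rather than residues, so that there are \<open>2^n\<close> of them even when \<open>m = 1\<close>.
\<close>

definition torus :: "nat \<Rightarrow> nat \<Rightarrow> (nat \<Rightarrow> int) set" where
  "torus m n = {1..n} \<rightarrow>\<^sub>E {0..<2 * int m}"

definition signs :: "nat \<Rightarrow> (nat \<Rightarrow> int) set" where
  "signs n = {1..n} \<rightarrow>\<^sub>E {-1, 1}"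

definition torus_add :: "nat \<Rightarrow> nat \<Rightarrow> (nat \<Rightarrow> int) \<Rightarrow> (nat \<Rightarrow> int) \<Rightarrow> (nat \<Rightarrow> int)" where
  "torus_add m n x v = (\<lambda>i\<in>{1..n}. (x i + v i) mod (2 * int m))"

definition torus_sub :: "nat \<Rightarrow> nat \<Rightarrow> (nat \<Rightarrow> int) \<Rightarrow> (nat \<Rightarrow> int) \<Rightarrow> (nat \<Rightarrow> int)" where
  "torus_sub m n x v = (\<lambda>i\<in>{1..n}. (x i - v i) mod (2 * int m))"

definition std_basis :: "nat \<Rightarrow> nat \<Rightarrow> int" where
  "std_basis j = (\<lambda>i. if i = j then 1 else 0)"

definition int_scale :: "int \<Rightarrow> (nat \<Rightarrow> int) \<Rightarrow> (nat \<Rightarrow> int)" where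
  "int_scale c v = (\<lambda>i. c * v i)"

definition D_long :: "nat \<Rightarrow> nat \<Rightarrow> ((nat \<Rightarrow> int) \<Rightarrow> real) \<Rightarrow> ((nat \<Rightarrow> int) \<times> nat \<Rightarrow> real)" where
  "D_long m n f = restrict
     (\<lambda>(x, j). f (torus_add m n x (int_scale (int m) (std_basis j))) - f x)
     (torus m n \<times> {1..n})"

definition D_sgn ::
  "nat \<Rightarrow> nat \<Rightarrow> ((nat \<Rightarrow> int) \<Rightarrow> real) \<Rightarrow> ((nat \<Rightarrow> int) \<times> (nat \<Rightarrow> int) \<Rightarrow> real)" where
  "D_sgn m n f = restrict (\<lambda>(x, \<epsilon>). f (torus_add m n x \<epsilon>) - f x) (torus m n \<times> signs n)"

definition D_long_adj ::
  "nat \<Rightarrow> nat \<Rightarrow> ((nat \<Rightarrow> int) \<times> nat \<Rightarrow> real) \<Rightarrow> ((nat \<Rightarrow> int) \<Rightarrow> real)" where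
  "D_long_adj m n g = (\<lambda>x\<in>torus m n.
     1 / real n *
       (\<Sum>j = 1..n. g (torus_sub m n x (int_scale (int m) (std_basis j)), j) - g (x, j)))"

definition D_sgn_adj ::
  "nat \<Rightarrow> nat \<Rightarrow> ((nat \<Rightarrow> int) \<times> (nat \<Rightarrow> int) \<Rightarrow> real) \<Rightarrow> ((nat \<Rightarrow> int) \<Rightarrow> real)" where
  "D_sgn_adj m n h = (\<lambda>x\<in>torus m n.
     1 / 2 ^ n * (\<Sum>\<epsilon>\<in>signs n. h (torus_sub m n x \<epsilon>, \<epsilon>) - h (x, \<epsilon>)))"

definition conj_exponent :: "real \<Rightarrow> ereal" where
  "conj_exponent p = (if p = 1 then \<infinity> else ereal (p / (p - 1)))"

text \<open>The norm of \<open>L\<^sub>r(\<Omega>; Y)\<close>, where \<open>nY\<close> is the norm of \<open>Y\<close>.\<close>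

definition Lr_norm :: "ereal \<Rightarrow> ('y \<Rightarrow> real) \<Rightarrow> 'a set \<Rightarrow> ('a \<Rightarrow> 'y) \<Rightarrow> real" where
  "Lr_norm r nY \<Omega> F =
     (if r = \<infinity> then Max ((\<lambda>\<omega>. nY (F \<omega>)) ` \<Omega>)
      else (1 / real (card \<Omega>) * (\<Sum>\<omega>\<in>\<Omega>. nY (F \<omega>) powr real_of_ereal r))
             powr (1 / real_of_ereal r))"

definition linf_space :: "nat \<Rightarrow> (nat \<Rightarrow> real) set" where
  "linf_space N = {1..N} \<rightarrow>\<^sub>E UNIV"

definition linf_norm :: "nat \<Rightarrow> (nat \<Rightarrow> real) \<Rightarrow> real" where
  "linf_norm N v = Max ((\<lambda>i. \<bar>v i\<bar>) ` {1..N})"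

definition linear_operator :: "'a set \<Rightarrow> 'b set \<Rightarrow> (('a \<Rightarrow> real) \<Rightarrow> ('b \<Rightarrow> real)) \<Rightarrow> bool" where
  "linear_operator \<Omega> \<Omega>' R \<longleftrightarrow>
     R \<in> (\<Omega> \<rightarrow>\<^sub>E UNIV) \<rightarrow> (\<Omega>' \<rightarrow>\<^sub>E UNIV) \<and>
     (\<forall>f\<in>\<Omega> \<rightarrow>\<^sub>E UNIV. \<forall>g\<in>\<Omega> \<rightarrow>\<^sub>E UNIV. \<forall>a b.
        R (\<lambda>\<omega>\<in>\<Omega>. a * f \<omega> + b * g \<omega>) = (\<lambda>\<omega>'\<in>\<Omega>'. a * R f \<omega>' + b * R g \<omega>'))"

text \<open>The operator \<open>R \<otimes> I\<close> on functions with values in \<open>\<ell>\<^sub>\<infinity>\<^sup>N\<close>.\<close>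

definition tensor_linf ::
  "nat \<Rightarrow> 'a set \<Rightarrow> 'b set \<Rightarrow> (('a \<Rightarrow> real) \<Rightarrow> ('b \<Rightarrow> real)) \<Rightarrow>
     ('a \<Rightarrow> nat \<Rightarrow> real) \<Rightarrow> ('b \<Rightarrow> nat \<Rightarrow> real)" where
  "tensor_linf N \<Omega> \<Omega>' R F = (\<lambda>\<omega>'\<in>\<Omega>'. \<lambda>i\<in>{1..N}. R (\<lambda>\<omega>\<in>\<Omega>. F \<omega> i) \<omega>')"

definition operator_norm :: "('x set) \<Rightarrow> ('x \<Rightarrow> real) \<Rightarrow> ('y \<Rightarrow> real) \<Rightarrow> ('x \<Rightarrow> 'y) \<Rightarrow> ereal" where
  "operator_norm X nX nY A = (SUP F\<in>{F \<in> X. nX F \<le> 1}. ereal (nY (A F)))"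

definition reg_norm ::
  "ereal \<Rightarrow> 'a set \<Rightarrow> 'b set \<Rightarrow> (('a \<Rightarrow> real) \<Rightarrow> ('b \<Rightarrow> real)) \<Rightarrow> ereal" where
  "reg_norm r \<Omega> \<Omega>' R =
     (SUP N\<in>{1..}. operator_norm (\<Omega> \<rightarrow>\<^sub>E linf_space N)
        (Lr_norm r (linf_norm N) \<Omega>) (Lr_norm r (linf_norm N) \<Omega>')
        (tensor_linf N \<Omega> \<Omega>' R))"

definition reg_const :: "ereal \<Rightarrow> nat \<Rightarrow> nat \<Rightarrow> ereal" where
  "reg_const r n m =
     (INF T\<in>{T. linear_operator (torus m n \<times> signs n) (torus m n \<times> {1..n}) T \<and>
                (\<forall>f\<in>torus m n \<rightarrow>\<^sub>E UNIV. T (D_sgn m n f) = D_long m n f)}.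
        reg_norm r (torus m n \<times> signs n) (torus m n \<times> {1..n}) T)"

definition reg_const_adj :: "ereal \<Rightarrow> nat \<Rightarrow> nat \<Rightarrow> ereal" where
  "reg_const_adj r n m =
     (INF S\<in>{S. linear_operator (torus m n \<times> {1..n}) (torus m n \<times> signs n) S \<and>
                (\<forall>g\<in>torus m n \<times> {1..n} \<rightarrow>\<^sub>E UNIV. D_sgn_adj m n (S g) = D_long_adj m n g)}.
        reg_norm r (torus m n \<times> {1..n}) (torus m n \<times> signs n) S)"

end

theory Submission
  imports Defs "HOL-Analysis.Convex"
begin

text \<open>
  The number \<open>m\<close> appears as the cyclic distance between \<open>x\<close> and \<open>x + m e\<^sub>j\<close>, measured in sign
  steps.

  Upper bound. When \<open>m\<close> is even or \<open>n = 1\<close>, a walk of \<open>m\<close> sign steps leads from \<open>x\<close> to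
  \<open>x + m e\<^sub>j\<close>: coordinate \<open>j\<close> keeps its direction and the other coordinates alternate. Summing the
  sign differences along the walk recovers the long difference, and averaging over all initial sign
  vectors makes every single step uniformly distributed on \<open>G \<times> \<Sigma>\<^sub>n\<close>. The resulting operator
  \<open>T\<close> and its adjoint \<open>S\<close> are \<open>m\<close> times an average along a measure-preserving map
  (\<open>walk_average_D_sgn\<close>, \<open>D_sgn_adj_walk_average_adj\<close>), and such an operator has regular norm at
  most \<open>m\<close> for every exponent by Jensen's inequality (\<open>reg_norm_le_of_measure_preserving\<close>).

  Lower bound. The regular norm of any matrix is at least the average of its absolute row sums
  (\<open>average_row_sum_le_reg_norm\<close>). The cyclic distance from \<open>x\<^sub>j\<close> in coordinate \<open>j\<close> changes by at
  most 1 along a sign step and by \<open>m\<close> from \<open>x\<close> to \<open>x + m e\<^sub>j\<close>. Inserting it into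
  \<open>T D_sgn = D_long\<close> shows that each row of \<open>T\<close> has absolute sum at least \<open>m\<close>; pairing it with
  \<open>D_sgn\<^sup>* S = D_long\<^sup>*\<close> at a point mass gives the corresponding bound for each column of \<open>S\<close>.

  Odd \<open>m\<close> and \<open>n \<ge> 2\<close>. The character \<open>(-1)^(x\<^sub>1 + x\<^sub>2)\<close> is invariant under sign steps but changes
  sign under the half-turn in coordinate 1. So \<open>D_sgn\<close> kills a function that \<open>D_long\<close> does not, and
  neither \<open>T\<close> nor \<open>S\<close> can exist.
\<close>

section \<open>Jensen inequalities for normalized norms\<close>

text \<open>
  Convexity on the open half-line extends to the endpoint 0 because \<open>t\<^sup>p \<le> t\<close> for \<open>t\<close> between 0
  and 1; norms do take the value 0.
\<close>

lemma convex_on_powr_nonneg: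
  assumes "1 \<le> (p::real)"
  shows "convex_on {0..} (\<lambda>x::real. x powr p)"
proof (rule convex_on_linorderI)
  fix t x y :: real
  assume t: "0 < t" "t < 1" and xy: "x \<in> {0..}" "y \<in> {0..}" "x < y"
  show "((1 - t) *\<^sub>R x + t *\<^sub>R y) powr p \<le> (1 - t) * x powr p + t * y powr p"
  proof (cases "x = 0")
    case True
    have "t powr p \<le> t powr 1"
      using t assms by (intro powr_mono') auto
    then show ?thesis
      using True t xy by (simp add: powr_mult mult_right_mono)
  next
    case False
    then show ?thesis
      using convex_onD[OF powr_convex[OF assms], of t x y] t xy by simp
  qed
qed simp

lemma average_powr_le:
  fixes u :: "'a \<Rightarrow> real"
  assumes "finite B" "B \<noteq> {}" "1 \<le> p" and u: "\<And>b. b \<in> B \<Longrightarrow> 0 \<le> u b"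
  shows "((\<Sum>b\<in>B. u b) / real (card B)) powr p \<le> (\<Sum>b\<in>B. u b powr p) / real (card B)"
proof -
  have "(\<Sum>b\<in>B. (1 / real (card B)) *\<^sub>R u b) powr p \<le> (\<Sum>b\<in>B. (1 / real (card B)) * u b powr p)"
    using assms
    by (intro convex_on_sum[OF _ _ convex_on_powr_nonneg[OF \<open>1 \<le> p\<close>]]) auto
  then show ?thesis
    by (simp add: sum_divide_distrib)
qed

lemma linf_norm_ge: "i \<in> {1..N} \<Longrightarrow> \<bar>v i\<bar> \<le> linf_norm N v"
  unfolding linf_norm_def by (intro Max_ge) auto

lemma linf_norm_le:
  assumes "1 \<le> N" "\<And>i. i \<in> {1..N} \<Longrightarrow> \<bar>v i\<bar> \<le> c"
  shows "linf_norm N v \<le> c"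
  unfolding linf_norm_def using assms by (subst Max_le_iff) auto

lemma linf_norm_nonneg: "1 \<le> N \<Longrightarrow> 0 \<le> linf_norm N v"
  using linf_norm_ge[of 1 N v] by force

lemma average_le_Lr_norm:
  assumes fin: "finite \<Omega>" "\<Omega> \<noteq> {}" and r: "1 \<le> r"
    and nonneg: "\<And>\<omega>. \<omega> \<in> \<Omega> \<Longrightarrow> 0 \<le> nY (F \<omega>)"
  shows "(\<Sum>\<omega>\<in>\<Omega>. nY (F \<omega>)) / real (card \<Omega>) \<le> Lr_norm r nY \<Omega> F"
proof (cases "r = \<infinity>")
  case True
  have "(\<Sum>\<omega>\<in>\<Omega>. nY (F \<omega>)) \<le> real (card \<Omega>) * Max ((\<lambda>\<omega>. nY (F \<omega>)) ` \<Omega>)"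
    using fin by (intro sum_bounded_above) auto
  then show ?thesis
    using True fin by (simp add: Lr_norm_def divide_le_eq card_gt_0_iff mult.commute)
next
  case False
  define q where "q = real_of_ereal r"
  have q: "1 \<le> q" "r = ereal q"
    using r False unfolding q_def by (cases r; simp)+
  let ?a = "(\<Sum>\<omega>\<in>\<Omega>. nY (F \<omega>)) / real (card \<Omega>)"
  have a: "0 \<le> ?a"
    using nonneg by (simp add: sum_nonneg)
  have "?a = (?a powr q) powr (1 / q)"
    using nonneg q by (simp add: powr_powr sum_nonneg)
  also have "\<dots> \<le> ((\<Sum>\<omega>\<in>\<Omega>. nY (F \<omega>) powr q) / real (card \<Omega>)) powr (1 / q)"
    using q average_powr_le[OF fin q(1) nonneg] by (intro powr_mono2) auto
  finally show ?thesis
    using q by (simp add: Lr_norm_def)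
qed

lemma Lr_norm_le_1:
  assumes "finite \<Omega>" "\<Omega> \<noteq> {}" "1 \<le> r"
    and "\<And>\<omega>. \<omega> \<in> \<Omega> \<Longrightarrow> 0 \<le> nY (F \<omega>) \<and> nY (F \<omega>) \<le> 1"
  shows "Lr_norm r nY \<Omega> F \<le> 1"
proof (cases "r = \<infinity>")
  case True
  then show ?thesis
    using assms by (simp add: Lr_norm_def)
next
  case False
  define q where "q = real_of_ereal r"
  have q: "1 \<le> q" "r = ereal q"
    using assms(3) False unfolding q_def by (cases r; simp)+
  have "(\<Sum>\<omega>\<in>\<Omega>. nY (F \<omega>) powr q) \<le> real (card \<Omega>) * 1"
    using assms(4) q by (intro sum_bounded_above powr_le1) auto
  then have "1 / real (card \<Omega>) * (\<Sum>\<omega>\<in>\<Omega>. nY (F \<omega>) powr q) \<le> 1"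
    using assms by (simp add: divide_le_eq card_gt_0_iff)
  then show ?thesis
    using q by (auto simp: Lr_norm_def sum_nonneg intro!: powr_le1)
qed

section \<open>Regular norm and row sums\<close>

definition unit_at :: "'a set \<Rightarrow> 'a \<Rightarrow> 'a \<Rightarrow> real" where
  "unit_at \<Omega> \<omega> = (\<lambda>\<omega>'\<in>\<Omega>. if \<omega>' = \<omega> then 1 else 0)"

lemma unit_at_extensional [simp]: "unit_at \<Omega> \<omega> \<in> \<Omega> \<rightarrow>\<^sub>E UNIV"
  by (simp add: unit_at_def)

lemma linear_operatorD:
  assumes "linear_operator \<Omega> \<Omega>' R" "f \<in> \<Omega> \<rightarrow>\<^sub>E UNIV" "g \<in> \<Omega> \<rightarrow>\<^sub>E UNIV"  "\<omega>' \<in> \<Omega>'"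
  shows "R (\<lambda>\<omega>\<in>\<Omega>. a * f \<omega> + b * g \<omega>) \<omega>' = a * R f \<omega>' + b * R g \<omega>'"
  using assms by (simp add: linear_operator_def)

lemma linear_operator_zero:
  assumes "linear_operator \<Omega> \<Omega>' R" "\<omega>' \<in> \<Omega>'"
  shows "R (\<lambda>\<omega>\<in>\<Omega>. 0) \<omega>' = 0"
proof -
  have "(\<lambda>\<omega>\<in>\<Omega>. 0::real) \<in> \<Omega> \<rightarrow>\<^sub>E UNIV"
    by simp
  from linear_operatorD[OF assms(1) this this assms(2), of 0 0] show ?thesis
    by simp
qed

text \<open>
  Adding the points of \<open>\<Omega>\<close> one at a time to the support of \<open>f\<close> uses only the binary form
  of linearity and the value at 0.
\<close>

lemma linear_operator_matrix:
  assumes R: "linear_operator \<Omega> \<Omega>' R" and "finite \<Omega>"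
    and f: "f \<in> \<Omega> \<rightarrow>\<^sub>E UNIV" and \<omega>': "\<omega>' \<in> \<Omega>'"
  shows "R f \<omega>' = (\<Sum>\<omega>\<in>\<Omega>. f \<omega> * R (unit_at \<Omega> \<omega>) \<omega>')"
proof -
  have "R (\<lambda>\<omega>\<in>\<Omega>. if \<omega> \<in> A then f \<omega> else 0) \<omega>' = (\<Sum>\<omega>\<in>A. f \<omega> * R (unit_at \<Omega> \<omega>) \<omega>')"
    if "finite A" "A \<subseteq> \<Omega>" for A
    using that
  proof (induction A rule: finite_induct)
    case empty
    then show ?case
      using linear_operator_zero[OF R \<omega>'] by (simp add: restrict_def)
  next
    case (insert a A)
    let ?g = "\<lambda>\<omega>\<in>\<Omega>. if \<omega> \<in> A then f \<omega> else 0"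
    have "(\<lambda>\<omega>\<in>\<Omega>. if \<omega> \<in> insert a A then f \<omega> else 0)
        = (\<lambda>\<omega>\<in>\<Omega>. 1 * ?g \<omega> + f a * unit_at \<Omega> a \<omega>)"
      using insert.hyps by (auto simp: unit_at_def)
    then have "R (\<lambda>\<omega>\<in>\<Omega>. if \<omega> \<in> insert a A then f \<omega> else 0) \<omega>'
        = 1 * R ?g \<omega>' + f a * R (unit_at \<Omega> a) \<omega>'"
      using linear_operatorD[OF R _ _ \<omega>', of ?g "unit_at \<Omega> a" 1 "f a"] by simp
    then show ?case
      using insert by (simp add: restrict_def)
  qed
  from this[of \<Omega>] have "R (\<lambda>\<omega>\<in>\<Omega>. if \<omega> \<in> \<Omega> then f \<omega> else 0) \<omega>' = (\<Sum>\<omega>\<in>\<Omega>. f \<omega> * R (unit_at \<Omega> \<omega>) \<omega>')"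
    using \<open>finite \<Omega>\<close> by simp
  moreover have "(\<lambda>\<omega>\<in>\<Omega>. if \<omega> \<in> \<Omega> then f \<omega> else 0) = f"
    using f by (auto simp: fun_eq_iff PiE_def extensional_def)
  ultimately show ?thesis
    by simp
qed

text \<open>
  Tensoring with \<open>\<ell>\<^sub>\<infinity>\<^sup>N\<close> for \<open>N = |\<Omega>'|\<close> gives one coordinate for each row of the matrix of
  \<open>R\<close>. If that coordinate of the test function carries the signs of its own row, the test
  function is bounded by 1 pointwise, while at \<open>\<omega>'\<close> no cancellation occurs in the
  coordinate of \<open>\<omega>'\<close>. Thus the regular norm dominates the norm of \<open>|R| 1\<close>, hence, as
  the exponent is at least 1, the average of \<open>|R| 1\<close>. The row sums concern the plain matrix
  entries, whatever the exponent, which is why one bound serves both for operators and for their adjoints.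
\<close>

lemma average_row_sum_le_reg_norm:
  assumes R: "linear_operator \<Omega> \<Omega>' R"
    and fin: "finite \<Omega>" "\<Omega> \<noteq> {}" "finite \<Omega>'" "\<Omega>' \<noteq> {}" and r: "1 \<le> r"
  shows "ereal ((\<Sum>\<omega>'\<in>\<Omega>'. \<Sum>\<omega>\<in>\<Omega>. \<bar>R (unit_at \<Omega> \<omega>) \<omega>'\<bar>) / real (card \<Omega>')) \<le> reg_norm r \<Omega> \<Omega>' R"
proof -
  define N where "N = card \<Omega>'"
  have N: "1 \<le> N"
    using fin by (simp add: N_def Suc_le_eq card_gt_0_iff)
  obtain e where e: "bij_betw e {1..N} \<Omega>'"
    using fin(3) ex_bij_betw_nat_finite_1 unfolding N_def by blast
  define F where
    "F = (\<lambda>\<omega>\<in>\<Omega>. \<lambda>i\<in>{1..N}. sgn (R (unit_at \<Omega> \<omega>) (e i)))"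
  let ?X = "{F \<in> \<Omega> \<rightarrow>\<^sub>E linf_space N. Lr_norm r (linf_norm N) \<Omega> F \<le> 1}"
  have "linf_norm N (F \<omega>) \<le> 1" if "\<omega> \<in> \<Omega>" for \<omega>
    using that by (intro linf_norm_le[OF N]) (simp add: F_def abs_sgn_eq)
  then have "Lr_norm r (linf_norm N) \<Omega> F \<le> 1"
    using fin r N by (intro Lr_norm_le_1) (auto intro: linf_norm_nonneg)
  then have F: "F \<in> ?X"
    by (simp add: F_def linf_space_def)
  let ?G = "tensor_linf N \<Omega> \<Omega>' R F"
  have row: "(\<Sum>\<omega>\<in>\<Omega>. \<bar>R (unit_at \<Omega> \<omega>) \<omega>'\<bar>) \<le> linf_norm N (?G \<omega>')" if \<omega>': "\<omega>' \<in> \<Omega>'" for \<omega>'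
  proof -
    obtain i where i: "i \<in> {1..N}" "e i = \<omega>'"
      using e \<omega>' unfolding bij_betw_def by blast
    have "?G \<omega>' i = (\<Sum>\<omega>\<in>\<Omega>. F \<omega> i * R (unit_at \<Omega> \<omega>) \<omega>')"
      using i \<omega>' linear_operator_matrix[OF R fin(1) _ \<omega>', of "\<lambda>\<omega>\<in>\<Omega>. F \<omega> i"]
      by (simp add: tensor_linf_def)
    also have "\<dots> = (\<Sum>\<omega>\<in>\<Omega>. \<bar>R (unit_at \<Omega> \<omega>) \<omega>'\<bar>)"
      using i by (intro sum.cong) (auto simp: F_def sgn_mult_self_eq abs_sgn mult.commute)
    finally show ?thesis
      using linf_norm_ge[OF i(1), of "?G \<omega>'"] by linarith
  qed
  have "(\<Sum>\<omega>'\<in>\<Omega>'. \<Sum>\<omega>\<in>\<Omega>. \<bar>R (unit_at \<Omega> \<omega>) \<omega>'\<bar>) / real (card \<Omega>')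
      \<le> (\<Sum>\<omega>'\<in>\<Omega>'. linf_norm N (?G \<omega>')) / real (card \<Omega>')"
    using row by (intro divide_right_mono sum_mono) auto
  also have "\<dots> \<le> Lr_norm r (linf_norm N) \<Omega>' ?G"
    using fin r N by (intro average_le_Lr_norm) (auto intro: linf_norm_nonneg)
  finally have "ereal ((\<Sum>\<omega>'\<in>\<Omega>'. \<Sum>\<omega>\<in>\<Omega>. \<bar>R (unit_at \<Omega> \<omega>) \<omega>'\<bar>) / real (card \<Omega>'))
      \<le> ereal (Lr_norm r (linf_norm N) \<Omega>' ?G)"
    by simp
  also have "\<dots> \<le> (SUP F\<in>?X. ereal (Lr_norm r (linf_norm N) \<Omega>' (tensor_linf N \<Omega> \<Omega>' R F)))"
    using F by (rule SUP_upper)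
  also have "\<dots> \<le> reg_norm r \<Omega> \<Omega>' R"
    unfolding reg_norm_def operator_norm_def using N by (intro SUP_upper) simp
  finally show ?thesis .
qed

section \<open>Averages along measure-preserving maps\<close>

definition average_along ::
  "real \<Rightarrow> 'b set \<Rightarrow> 'c set \<Rightarrow> ('b \<Rightarrow> 'c \<Rightarrow> 'a) \<Rightarrow> ('a \<Rightarrow> real) \<Rightarrow> 'b \<Rightarrow> real" where
  "average_along C \<Omega>' B \<phi> f = (\<lambda>\<omega>'\<in>\<Omega>'. C * ((\<Sum>b\<in>B. f (\<phi> \<omega>' b)) / real (card B)))"

lemma linear_operator_average_along:
  assumes "\<And>\<omega>' b. \<omega>' \<in> \<Omega>' \<Longrightarrow> b \<in> B \<Longrightarrow> \<phi> \<omega>' b \<in> \<Omega>"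
  shows "linear_operator \<Omega> \<Omega>' (average_along C \<Omega>' B \<phi>)"
  unfolding linear_operator_def average_along_def using assms
  by (auto simp: fun_eq_iff sum.distrib sum_distrib_left add_divide_distrib algebra_simps
      simp flip: sum_distrib_left)

text \<open>
  Averages over a finite set commute with evaluation of a coordinate, so the
  \<open>\<ell>\<^sub>\<infinity>\<close>-valued norm of \<open>R F\<close> at \<open>\<omega>'\<close> is at most \<open>C\<close> times the average of the scalar function
  \<open>|F|\<close> along \<open>\<phi> \<omega>'\<close>. Jensen moves the power inside the average, and the hypothesis \<open>pres\<close>,
  that \<open>\<phi>\<close> carries the uniform measure of \<open>\<Omega>' \<times> B\<close> to that of \<open>\<Omega>\<close>, turns the result into the
  norm of \<open>F\<close>. The bound is therefore the same for every exponent.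
\<close>

lemma reg_norm_le_of_measure_preserving:
  assumes fin: "finite \<Omega>" "\<Omega> \<noteq> {}" "finite \<Omega>'" "\<Omega>' \<noteq> {}" "finite B" "B \<noteq> {}"
    and r: "1 \<le> r" and C: "0 \<le> C"
    and R: "\<And>f \<omega>'. f \<in> \<Omega> \<rightarrow>\<^sub>E UNIV \<Longrightarrow> \<omega>' \<in> \<Omega>' \<Longrightarrow> R f \<omega>' = C * ((\<Sum>b\<in>B. f (\<phi> \<omega>' b)) / real (card B))"
    and \<phi>: "\<And>\<omega>' b. \<omega>' \<in> \<Omega>' \<Longrightarrow> b \<in> B \<Longrightarrow> \<phi> \<omega>' b \<in> \<Omega>"
    and pres: "\<And>u :: 'a \<Rightarrow> real. (\<Sum>\<omega>'\<in>\<Omega>'. (\<Sum>b\<in>B. u (\<phi> \<omega>' b)) / real (card B)) / real (card \<Omega>')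
      = (\<Sum>\<omega>\<in>\<Omega>. u \<omega>) / real (card \<Omega>)"
  shows "reg_norm r \<Omega> \<Omega>' R \<le> ereal C"
  unfolding reg_norm_def operator_norm_def
proof (intro SUP_least)
  fix N :: nat and F
  assume "N \<in> {1..}" and "F \<in> {F \<in> \<Omega> \<rightarrow>\<^sub>E linf_space N. Lr_norm r (linf_norm N) \<Omega> F \<le> 1}"
  then have N: "1 \<le> N" and F1: "Lr_norm r (linf_norm N) \<Omega> F \<le> 1"
    by auto
  let ?G = "tensor_linf N \<Omega> \<Omega>' R F"
  define u where "u = (\<lambda>\<omega>. linf_norm N (F \<omega>))"
  have u0: "0 \<le> u \<omega>" for \<omega>
    using N by (simp add: u_def linf_norm_nonneg)
  have card: "0 < card \<Omega>" "0 < card \<Omega>'" "0 < card B"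
    using fin by (auto simp: card_gt_0_iff)
  define a where "a = (\<lambda>\<omega>'. (\<Sum>b\<in>B. u (\<phi> \<omega>' b)) / real (card B))"
  have a0: "0 \<le> a \<omega>'" for \<omega>'
    using u0 by (simp add: a_def sum_nonneg)
  have pointwise: "linf_norm N (?G \<omega>') \<le> C * a \<omega>'" if \<omega>': "\<omega>' \<in> \<Omega>'" for \<omega>'
  proof (rule linf_norm_le[OF N])
    fix i assume i: "i \<in> {1..N}"
    have "\<bar>?G \<omega>' i\<bar> = C * (\<bar>\<Sum>b\<in>B. F (\<phi> \<omega>' b) i\<bar> / real (card B))"
      using i \<omega>' \<phi> C by (simp add: tensor_linf_def R abs_mult)
    also have "\<dots> \<le> C * a \<omega>'"
      unfolding a_def u_def using C i
      by (intro mult_left_mono divide_right_mono order_trans[OF sum_abs] sum_mono linf_norm_ge) auto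
    finally show "\<bar>?G \<omega>' i\<bar> \<le> C * a \<omega>'" .
  qed
  have "Lr_norm r (linf_norm N) \<Omega>' ?G \<le> C"
  proof (cases "r = \<infinity>")
    case True
    have u1: "u \<omega> \<le> 1" if "\<omega> \<in> \<Omega>" for \<omega>
      using that F1 fin True by (simp add: Lr_norm_def u_def)
    have "a \<omega>' \<le> 1" if "\<omega>' \<in> \<Omega>'" for \<omega>'
    proof -
      have "(\<Sum>b\<in>B. u (\<phi> \<omega>' b)) \<le> real (card B) * 1"
        using that \<phi> u1 by (intro sum_bounded_above) auto
      then show ?thesis
        using card by (simp add: a_def divide_le_eq)
    qed
    then have "linf_norm N (?G \<omega>') \<le> C" if "\<omega>' \<in> \<Omega>'" for \<omega>'
      using that pointwise[OF that] C mult_left_mono[of "a \<omega>'" 1 C] by fastforce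
    then show ?thesis
      using True fin by (simp add: Lr_norm_def)
  next
    case False
    define q where "q = real_of_ereal r"
    have q: "1 \<le> q" "r = ereal q"
      using r False unfolding q_def by (cases r; simp)+
    have "linf_norm N (?G \<omega>') powr q \<le> C powr q * ((\<Sum>b\<in>B. u (\<phi> \<omega>' b) powr q) / real (card B))"
      if "\<omega>' \<in> \<Omega>'" for \<omega>'
    proof -
      have "linf_norm N (?G \<omega>') powr q \<le> (C * a \<omega>') powr q"
        using pointwise[OF that] q N by (intro powr_mono2) (auto intro: linf_norm_nonneg)
      also have "\<dots> = C powr q * a \<omega>' powr q"
        using C a0 by (simp add: powr_mult)
      also have "\<dots> \<le> C powr q * ((\<Sum>b\<in>B. u (\<phi> \<omega>' b) powr q) / real (card B))"
        unfolding a_def using fin q u0 by (intro mult_left_mono average_powr_le) auto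
      finally show ?thesis .
    qed
    then have "(\<Sum>\<omega>'\<in>\<Omega>'. linf_norm N (?G \<omega>') powr q) / real (card \<Omega>')
        \<le> (\<Sum>\<omega>'\<in>\<Omega>'. C powr q * ((\<Sum>b\<in>B. u (\<phi> \<omega>' b) powr q) / real (card B))) / real (card \<Omega>')"
      by (intro divide_right_mono sum_mono) auto
    also have "\<dots> = C powr q * ((\<Sum>\<omega>\<in>\<Omega>. u \<omega> powr q) / real (card \<Omega>))"
      unfolding pres[of "\<lambda>\<omega>. u \<omega> powr q", symmetric] sum_distrib_left[symmetric] by simp
    finally have "Lr_norm r (linf_norm N) \<Omega>' ?G
        \<le> (C powr q * ((\<Sum>\<omega>\<in>\<Omega>. u \<omega> powr q) / real (card \<Omega>))) powr (1 / q)"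
      using q by (auto simp: Lr_norm_def intro!: powr_mono2 divide_nonneg_nonneg sum_nonneg)
    also have "\<dots> = C * Lr_norm r (linf_norm N) \<Omega> F"
      using q C
      by (subst powr_mult) (simp_all add: Lr_norm_def u_def powr_powr)
    also have "\<dots> \<le> C"
      using F1 C mult_left_mono[OF F1 C] by simp
    finally show ?thesis .
  qed
  then show "ereal (Lr_norm r (linf_norm N) \<Omega>' ?G) \<le> ereal C"
    by simp
qed

section \<open>Summation by parts on the torus\<close>

lemma finite_torus [simp]: "finite (torus m n)"
  by (simp add: torus_def finite_PiE)

lemma finite_signs [simp]: "finite (signs n)"
  by (simp add: signs_def finite_PiE)

lemma card_signs [simp]: "card (signs n) = 2 ^ n"
  by (simp add: signs_def card_PiE numeral_2_eq_2)

lemma signs_nonempty [simp]: "signs n \<noteq> {}"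
  by (simp add: signs_def PiE_eq_empty_iff)

lemma torus_nonempty [simp]: "1 \<le> m \<Longrightarrow> torus m n \<noteq> {}"
  by (simp add: torus_def PiE_eq_empty_iff)

lemma card_torus_pos: "1 \<le> m \<Longrightarrow> 0 < card (torus m n)"
  by (simp add: card_gt_0_iff)

lemma torus_add_in [simp]: "1 \<le> m \<Longrightarrow> torus_add m n x v \<in> torus m n"
  by (auto simp: torus_add_def torus_def)

lemma torus_sub_in [simp]: "1 \<le> m \<Longrightarrow> torus_sub m n x v \<in> torus m n"
  by (auto simp: torus_sub_def torus_def)

lemma torus_sub_add [simp]:
  assumes "x \<in> torus m n"
  shows "torus_sub m n (torus_add m n x v) v = x"
  using assms by (auto simp: torus_sub_def torus_add_def torus_def fun_eq_iff mod_diff_left_eq PiE_def extensional_def Pi_def)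

lemma torus_add_sub [simp]:
  assumes "x \<in> torus m n"
  shows "torus_add m n (torus_sub m n x v) v = x"
  using assms by (auto simp: torus_sub_def torus_add_def torus_def fun_eq_iff mod_add_left_eq PiE_def extensional_def Pi_def)

lemma bij_torus_add:
  "1 \<le> m \<Longrightarrow> bij_betw (\<lambda>x. torus_add m n x v) (torus m n) (torus m n)"
  by (rule bij_betw_byWitness[where f' = "\<lambda>x. torus_sub m n x v"]) auto

lemma bij_torus_sub:
  "1 \<le> m \<Longrightarrow> bij_betw (\<lambda>x. torus_sub m n x v) (torus m n) (torus m n)"
  by (rule bij_betw_byWitness[where f' = "\<lambda>x. torus_add m n x v"]) auto

lemma sum_by_parts_torus:
  fixes f h :: "(nat \<Rightarrow> int) \<Rightarrow> real"
  assumes "1 \<le> m"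
  shows "(\<Sum>x\<in>torus m n. f x * (h (torus_sub m n x v) - h x))
    = (\<Sum>x\<in>torus m n. (f (torus_add m n x v) - f x) * h x)"
proof -
  have "(\<Sum>x\<in>torus m n. f x * h (torus_sub m n x v))
      = (\<Sum>x\<in>torus m n. f (torus_add m n x v) * h (torus_sub m n (torus_add m n x v) v))"
    by (rule sum.reindex_bij_betw[OF bij_torus_add[OF assms], symmetric])
  also have "\<dots> = (\<Sum>x\<in>torus m n. f (torus_add m n x v) * h x)"
    by (intro sum.cong) auto
  finally show ?thesis
    by (simp add: algebra_simps sum_subtractf)
qed

lemma D_sgn_adjoint:
  assumes "1 \<le> m"
  shows "(\<Sum>x\<in>torus m n. f x * D_sgn_adj m n h x)
    = 1 / 2 ^ n * (\<Sum>\<omega>\<in>torus m n \<times> signs n. D_sgn m n f \<omega> * h \<omega>)"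
proof -
  have "(\<Sum>x\<in>torus m n. f x * D_sgn_adj m n h x)
      = 1 / 2 ^ n * (\<Sum>x\<in>torus m n. \<Sum>\<epsilon>\<in>signs n. f x * (h (torus_sub m n x \<epsilon>, \<epsilon>) - h (x, \<epsilon>)))"
    by (simp add: D_sgn_adj_def sum_distrib_left mult_ac)
  also have "\<dots> = 1 / 2 ^ n * (\<Sum>\<epsilon>\<in>signs n. \<Sum>x\<in>torus m n. f x * (h (torus_sub m n x \<epsilon>, \<epsilon>) - h (x, \<epsilon>)))"
    by (subst sum.swap) simp
  also have "\<dots> = 1 / 2 ^ n * (\<Sum>\<epsilon>\<in>signs n. \<Sum>x\<in>torus m n. (f (torus_add m n x \<epsilon>) - f x) * h (x, \<epsilon>))"
    using sum_by_parts_torus[OF assms, where h = "\<lambda>x. h (x, _)"] by simp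
  also have "\<dots> = 1 / 2 ^ n * (\<Sum>x\<in>torus m n. \<Sum>\<epsilon>\<in>signs n. D_sgn m n f (x, \<epsilon>) * h (x, \<epsilon>))"
    by (subst sum.swap) (simp add: D_sgn_def)
  finally show ?thesis
    by (simp add: sum.cartesian_product)
qed

lemma D_long_adjoint:
  assumes "1 \<le> m"
  shows "(\<Sum>x\<in>torus m n. f x * D_long_adj m n g x)
    = 1 / real n * (\<Sum>\<omega>\<in>torus m n \<times> {1..n}. D_long m n f \<omega> * g \<omega>)"
proof -
  let ?v = "\<lambda>j. int_scale (int m) (std_basis j)"
  have "(\<Sum>x\<in>torus m n. f x * D_long_adj m n g x)
      = 1 / real n * (\<Sum>x\<in>torus m n. \<Sum>j=1..n. f x * (g (torus_sub m n x (?v j), j) - g (x, j)))"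
    by (simp add: D_long_adj_def sum_distrib_left mult_ac)
  also have "\<dots> = 1 / real n * (\<Sum>j=1..n. \<Sum>x\<in>torus m n. f x * (g (torus_sub m n x (?v j), j) - g (x, j)))"
    by (subst sum.swap) simp
  also have "\<dots> = 1 / real n * (\<Sum>j=1..n. \<Sum>x\<in>torus m n. (f (torus_add m n x (?v j)) - f x) * g (x, j))"
    using sum_by_parts_torus[OF assms, where h = "\<lambda>x. g (x, _)"] by simp
  also have "\<dots> = 1 / real n * (\<Sum>x\<in>torus m n. \<Sum>j=1..n. D_long m n f (x, j) * g (x, j))"
    by (subst sum.swap) (simp add: D_long_def)
  finally show ?thesis
    by (simp add: sum.cartesian_product)
qed

text \<open>
  Testing \<open>D_sgn\<^sup>* S = D_long\<^sup>*\<close> on a point mass and pairing with \<open>f\<close> expresses a value of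
  \<open>D_long f\<close> through one column of \<open>S\<close>: it is the transposed form of \<open>T D_sgn = D_long\<close>.
\<close>

lemma adjoint_lift_pairing:
  assumes m: "1 \<le> m"
    and S: "\<forall>g\<in>torus m n \<times> {1..n} \<rightarrow>\<^sub>E UNIV. D_sgn_adj m n (S g) = D_long_adj m n g"
    and x: "x \<in> torus m n" "j \<in> {1..n}"
  shows "1 / 2 ^ n * (\<Sum>\<omega>\<in>torus m n \<times> signs n.
      D_sgn m n f \<omega> * S (unit_at (torus m n \<times> {1..n}) (x, j)) \<omega>) = 1 / real n * D_long m n f (x, j)"
proof -
  let ?\<Omega> = "torus m n \<times> {1..n}"
  have "(\<Sum>\<omega>\<in>?\<Omega>. D_long m n f \<omega> * unit_at ?\<Omega> (x, j) \<omega>)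
      = (\<Sum>\<omega>\<in>?\<Omega>. if \<omega> = (x, j) then D_long m n f \<omega> else 0)"
    by (intro sum.cong) (auto simp: unit_at_def)
  also have "\<dots> = D_long m n f (x, j)"
    using x by (subst sum.delta) auto
  finally show ?thesis
    using D_sgn_adjoint[OF m, of f n "S (unit_at ?\<Omega> (x, j))"]
      D_long_adjoint[OF m, of f n "unit_at ?\<Omega> (x, j)"] S by simp
qed

section \<open>The lower bound: distance functions\<close>

text \<open>
  The distance from a residue to 0 around the cycle of length \<open>2m\<close>.
\<close>

definition cyclic_length :: "nat \<Rightarrow> int \<Rightarrow> int" where
  "cyclic_length m t = min (t mod (2 * int m)) (2 * int m - t mod (2 * int m))"

lemma cyclic_length_mod_diff: "cyclic_length m (s mod (2 * int m) - t) = cyclic_length m (s - t)"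
  by (simp add: cyclic_length_def mod_diff_left_eq)

lemma cyclic_length_0: "cyclic_length m 0 = 0"
  by (simp add: cyclic_length_def)

lemma cyclic_length_half: "1 \<le> m \<Longrightarrow> cyclic_length m (int m) = int m"
  by (simp add: cyclic_length_def)

lemma cyclic_length_Suc:
  assumes "1 \<le> m"
  shows "\<bar>cyclic_length m (t + 1) - cyclic_length m t\<bar> \<le> 1"
proof -
  define M where "M = 2 * int m"
  have "0 < M" using assms by (simp add: M_def)
  then have "0 \<le> t mod M" "t mod M < M" by auto
  moreover have "(t + 1) mod M = (if t mod M = M - 1 then 0 else t mod M + 1)"
    using \<open>0 < M\<close> calculation
    by (subst mod_add_left_eq[symmetric]) auto
  ultimately show ?thesis
    unfolding cyclic_length_def M_def[symmetric] by auto
qed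

lemma cyclic_length_step:
  assumes "1 \<le> m" "e \<in> {-1, 1}"
  shows "\<bar>cyclic_length m (t + e) - cyclic_length m t\<bar> \<le> 1"
  using assms cyclic_length_Suc[OF assms(1), of t] cyclic_length_Suc[OF assms(1), of "t - 1"]
  by auto

text \<open>
  The cyclic distance in coordinate \<open>j\<close> from the base point \<open>x\<close>. It is the extremal test
  function: a sign step changes it by at most 1, but going from \<open>x\<close> to \<open>x + m e\<^sub>j\<close> raises
  it from 0 to the diameter \<open>m\<close>.
\<close>

definition tent :: "nat \<Rightarrow> nat \<Rightarrow> (nat \<Rightarrow> int) \<Rightarrow> nat \<Rightarrow> (nat \<Rightarrow> int) \<Rightarrow> real" where
  "tent m n x j = (\<lambda>y\<in>torus m n. of_int (cyclic_length m (y j - x j)))"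

lemma tent_extensional [simp]: "tent m n x j \<in> torus m n \<rightarrow>\<^sub>E UNIV"
  by (simp add: tent_def)

lemma D_sgn_tent_le:
  assumes m: "1 \<le> m" and j: "j \<in> {1..n}" and \<omega>: "\<omega> \<in> torus m n \<times> signs n"
  shows "\<bar>D_sgn m n (tent m n x j) \<omega>\<bar> \<le> 1"
proof -
  obtain y \<epsilon> where [simp]: "\<omega> = (y, \<epsilon>)" and y: "y \<in> torus m n" "\<epsilon> \<in> signs n"
    using \<omega> by auto
  have \<epsilon>: "\<epsilon> j \<in> {-1, 1}"
    using y j by (auto simp: signs_def)
  have "D_sgn m n (tent m n x j) \<omega>
      = of_int (cyclic_length m (y j - x j + \<epsilon> j) - cyclic_length m (y j - x j))"
    using m j y by (simp add: D_sgn_def tent_def) (simp add: torus_add_def cyclic_length_mod_diff diff_add_eq)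
  then show ?thesis
    using cyclic_length_step[OF m \<epsilon>, of "y j - x j"] by linarith
qed

lemma D_long_tent:
  assumes m: "1 \<le> m" and x: "j \<in> {1..n}" "x \<in> torus m n"
  shows "D_long m n (tent m n x j) (x, j) = real m"
  using assms by (simp add: D_long_def tent_def)
    (simp add: torus_add_def cyclic_length_mod_diff int_scale_def std_basis_def
      cyclic_length_0 cyclic_length_half)

lemma sum_mult_le_sum_abs:
  fixes h s :: "'a \<Rightarrow> real"
  assumes "\<And>\<omega>. \<omega> \<in> A \<Longrightarrow> \<bar>h \<omega>\<bar> \<le> 1"
  shows "(\<Sum>\<omega>\<in>A. h \<omega> * s \<omega>) \<le> (\<Sum>\<omega>\<in>A. \<bar>s \<omega>\<bar>)"
proof (rule sum_mono)
  fix \<omega> assume "\<omega> \<in> A"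
  then have "\<bar>h \<omega>\<bar> * \<bar>s \<omega>\<bar> \<le> 1 * \<bar>s \<omega>\<bar>"
    using assms by (intro mult_right_mono) auto
  then show "h \<omega> * s \<omega> \<le> \<bar>s \<omega>\<bar>"
    by (simp add: abs_mult[symmetric])
qed

text \<open>
  The tent based at \<open>(x, j)\<close> forces the row of \<open>T\<close> at \<open>(x, j)\<close> to have absolute sum at least
  \<open>m\<close>, so the average row sum is at least \<open>m\<close> as well.
\<close>

lemma reg_const_ge:
  assumes m: "1 \<le> m" and n: "1 \<le> n" and r: "1 \<le> r"
  shows "ereal (real m) \<le> reg_const r n m"
  unfolding reg_const_def
proof (intro INF_greatest, clarify)
  fix T
  assume T: "linear_operator (torus m n \<times> signs n) (torus m n \<times> {1..n}) T"
    and lift: "\<forall>f\<in>torus m n \<rightarrow>\<^sub>E UNIV. T (D_sgn m n f) = D_long m n f"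
  let ?\<Omega> = "torus m n \<times> signs n" and ?\<Omega>' = "torus m n \<times> {1..n}"
  have row: "real m \<le> (\<Sum>\<omega>\<in>?\<Omega>. \<bar>T (unit_at ?\<Omega> \<omega>) \<omega>'\<bar>)" if \<omega>': "\<omega>' \<in> ?\<Omega>'" for \<omega>'
  proof -
    obtain x j where [simp]: "\<omega>' = (x, j)" and x: "x \<in> torus m n" "j \<in> {1..n}"
      using \<omega>' by auto
    let ?h = "D_sgn m n (tent m n x j)"
    have "real m = T ?h \<omega>'"
      using lift D_long_tent[OF m x(2) x(1)] by simp
    also have "\<dots> = (\<Sum>\<omega>\<in>?\<Omega>. ?h \<omega> * T (unit_at ?\<Omega> \<omega>) \<omega>')"
      using \<omega>' by (intro linear_operator_matrix[OF T]) (auto simp: D_sgn_def)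
    also have "\<dots> \<le> (\<Sum>\<omega>\<in>?\<Omega>. \<bar>T (unit_at ?\<Omega> \<omega>) \<omega>'\<bar>)"
      using D_sgn_tent_le[OF m x(2)] by (rule sum_mult_le_sum_abs)
    finally show ?thesis .
  qed
  have nonempty: "?\<Omega>' \<noteq> {}"
    using m n by (simp add: Sigma_empty_iff)
  have "real (card ?\<Omega>') * real m \<le> (\<Sum>\<omega>'\<in>?\<Omega>'. \<Sum>\<omega>\<in>?\<Omega>. \<bar>T (unit_at ?\<Omega> \<omega>) \<omega>'\<bar>)"
    using row by (rule sum_bounded_below)
  then have "ereal (real m) \<le> ereal ((\<Sum>\<omega>'\<in>?\<Omega>'. \<Sum>\<omega>\<in>?\<Omega>. \<bar>T (unit_at ?\<Omega> \<omega>) \<omega>'\<bar>) / real (card ?\<Omega>'))"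
    using nonempty by (simp add: le_divide_eq card_gt_0_iff mult.commute del: card_cartesian_product)
  also have "\<dots> \<le> reg_norm r ?\<Omega> ?\<Omega>' T"
    using m n r nonempty by (intro average_row_sum_le_reg_norm[OF T]) auto
  finally show "ereal (real m) \<le> reg_norm r ?\<Omega> ?\<Omega>' T" .
qed

text \<open>
  For \<open>S\<close> the tents bound absolute column sums rather than row sums. Only the total of all
  absolute entries enters the average row sum, so interchanging the two summations is enough; the
  weights \<open>1/n\<close> and \<open>2^-n\<close> of the two adjoints compensate for the different cardinalities
  of the two index sets.
\<close>

lemma reg_const_adj_ge:
  assumes m: "1 \<le> m" and n: "1 \<le> n" and r: "1 \<le> r"
  shows "ereal (real m) \<le> reg_const_adj r n m"
  unfolding reg_const_adj_def
proof (intro INF_greatest, clarify)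
  fix S
  let ?\<Omega> = "torus m n \<times> {1..n}" and ?\<Omega>' = "torus m n \<times> signs n"
  assume S: "linear_operator ?\<Omega> ?\<Omega>' S"
    and lift: "\<forall>g\<in>?\<Omega> \<rightarrow>\<^sub>E UNIV. D_sgn_adj m n (S g) = D_long_adj m n g"
  have column: "2 ^ n / real n * real m \<le> (\<Sum>\<omega>'\<in>?\<Omega>'. \<bar>S (unit_at ?\<Omega> \<omega>) \<omega>'\<bar>)"
    if \<omega>: "\<omega> \<in> ?\<Omega>" for \<omega>
  proof -
    obtain x j where [simp]: "\<omega> = (x, j)" and x: "x \<in> torus m n" "j \<in> {1..n}"
      using \<omega> by auto
    let ?h = "D_sgn m n (tent m n x j)"
    have "1 / 2 ^ n * (\<Sum>\<omega>'\<in>?\<Omega>'. ?h \<omega>' * S (unit_at ?\<Omega> \<omega>) \<omega>') = 1 / real n * real m"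
      using adjoint_lift_pairing[OF m lift x, of "tent m n x j"] D_long_tent[OF m x(2,1)] by simp
    then have "2 ^ n / real n * real m = (\<Sum>\<omega>'\<in>?\<Omega>'. ?h \<omega>' * S (unit_at ?\<Omega> \<omega>) \<omega>')"
      using n by (simp add: field_simps)
    also have "\<dots> \<le> (\<Sum>\<omega>'\<in>?\<Omega>'. \<bar>S (unit_at ?\<Omega> \<omega>) \<omega>'\<bar>)"
      using D_sgn_tent_le[OF m x(2)] by (rule sum_mult_le_sum_abs)
    finally show ?thesis .
  qed
  have "real (card ?\<Omega>) * (2 ^ n / real n * real m)
      \<le> (\<Sum>\<omega>\<in>?\<Omega>. \<Sum>\<omega>'\<in>?\<Omega>'. \<bar>S (unit_at ?\<Omega> \<omega>) \<omega>'\<bar>)"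
    using column by (rule sum_bounded_below)
  also have "\<dots> = (\<Sum>\<omega>'\<in>?\<Omega>'. \<Sum>\<omega>\<in>?\<Omega>. \<bar>S (unit_at ?\<Omega> \<omega>) \<omega>'\<bar>)"
    by (rule sum.swap)
  also have "real (card ?\<Omega>) * (2 ^ n / real n * real m) = real (card ?\<Omega>') * real m"
    using n by simp
  finally have "ereal (real m) \<le> ereal ((\<Sum>\<omega>'\<in>?\<Omega>'. \<Sum>\<omega>\<in>?\<Omega>. \<bar>S (unit_at ?\<Omega> \<omega>) \<omega>'\<bar>) / real (card ?\<Omega>'))"
    using card_torus_pos[OF m, of n] by (simp add: le_divide_eq mult_ac)
  also have "\<dots> \<le> reg_norm r ?\<Omega> ?\<Omega>' S"
    using m n r by (intro average_row_sum_le_reg_norm[OF S]) (auto simp: Sigma_empty_iff)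
  finally show "ereal (real m) \<le> reg_norm r ?\<Omega> ?\<Omega>' S" .
qed

section \<open>Non-existence for odd half-periods\<close>

text \<open>
  A sign step changes both \<open>x\<^sub>1\<close> and \<open>x\<^sub>2\<close> by an odd number, hence preserves the parity of
  \<open>x\<^sub>1 + x\<^sub>2\<close>, while a half-turn in coordinate 1 by an odd \<open>m\<close> reverses it. So this character is
  annihilated by \<open>D_sgn\<close> but not by \<open>D_long\<close>. Parity is well defined on residues since the
  period \<open>2m\<close> is even.
\<close>

definition parity_character :: "nat \<Rightarrow> nat \<Rightarrow> (nat \<Rightarrow> int) \<Rightarrow> real" where
  "parity_character m n = (\<lambda>x\<in>torus m n. if even (x 1 + x 2) then 1 else -1)"

lemma parity_character_extensional [simp]: "parity_character m n \<in> torus m n \<rightarrow>\<^sub>E UNIV"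
  by (simp add: parity_character_def)

lemma even_mod_double: "even (a mod (2 * int m)) \<longleftrightarrow> even a"
  by (simp add: dvd_mod_iff)

lemma D_sgn_parity_character:
  assumes "1 \<le> m" "2 \<le> n"
  shows "D_sgn m n (parity_character m n) = (\<lambda>\<omega>\<in>torus m n \<times> signs n. 0)"
proof -
  have "odd (\<epsilon> i)" if "\<epsilon> \<in> signs n" "i \<in> {1..n}" for \<epsilon> i
    using that by (force simp: signs_def PiE_def Pi_def)
  then have "odd (\<epsilon> 1) \<and> odd (\<epsilon> 2)" if "\<epsilon> \<in> signs n" for \<epsilon>
    using that assms by auto
  then show ?thesis
    using assms unfolding D_sgn_def parity_character_def
    by (intro restrict_ext) (auto, auto simp: torus_add_def even_mod_double)
qed

lemma D_long_parity_character:
  assumes "odd m" "2 \<le> n" "x \<in> torus m n"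
  shows "D_long m n (parity_character m n) (x, 1) \<noteq> 0"
proof -
  have "1 \<le> m"
    using assms(1) by (cases m) auto
  then show ?thesis
    using assms
    by (auto simp: D_long_def parity_character_def)
      (auto simp: torus_add_def int_scale_def std_basis_def even_mod_double)
qed

lemma reg_const_eq_infinity:
  assumes "odd m" "2 \<le> n"
  shows "reg_const r n m = \<infinity>"
proof -
  have m: "1 \<le> m"
    using assms(1) by (cases m) auto
  obtain x where x: "x \<in> torus m n"
    using torus_nonempty[OF m] by blast
  have False if T: "linear_operator (torus m n \<times> signs n) (torus m n \<times> {1..n}) T"
    and lift: "\<forall>f\<in>torus m n \<rightarrow>\<^sub>E UNIV. T (D_sgn m n f) = D_long m n f" for T
  proof -
    have "D_long m n (parity_character m n) = T (\<lambda>\<omega>\<in>torus m n \<times> signs n. 0)"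
      using lift D_sgn_parity_character[OF m assms(2)] by (metis parity_character_extensional)
    then have "D_long m n (parity_character m n) (x, 1) = 0"
      using linear_operator_zero[OF T, of "(x, 1)"] x assms(2) by simp
    then show False
      using D_long_parity_character[OF assms x] by simp
  qed
  then have "{T. linear_operator (torus m n \<times> signs n) (torus m n \<times> {1..n}) T \<and>
      (\<forall>f\<in>torus m n \<rightarrow>\<^sub>E UNIV. T (D_sgn m n f) = D_long m n f)} = {}"
    by blast
  then show ?thesis
    unfolding reg_const_def by (simp only: image_empty Inf_empty top_ereal_def)
qed

lemma reg_const_adj_eq_infinity:
  assumes "odd m" "2 \<le> n"
  shows "reg_const_adj r n m = \<infinity>"
proof -
  have m: "1 \<le> m"
    using assms(1) by (cases m) auto
  obtain x where x: "x \<in> torus m n"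
    using torus_nonempty[OF m] by blast
  have False
    if lift: "\<forall>g\<in>torus m n \<times> {1..n} \<rightarrow>\<^sub>E UNIV. D_sgn_adj m n (S g) = D_long_adj m n g" for S
  proof -
    have "1 / real n * D_long m n (parity_character m n) (x, 1) = 0"
      using assms(2) adjoint_lift_pairing[OF m lift x, of 1 "parity_character m n"]
        D_sgn_parity_character[OF m assms(2)] by simp
    then show False
      using D_long_parity_character[OF assms x] assms(2) by simp
  qed
  then have "{S. linear_operator (torus m n \<times> {1..n}) (torus m n \<times> signs n) S \<and>
      (\<forall>g\<in>torus m n \<times> {1..n} \<rightarrow>\<^sub>E UNIV. D_sgn_adj m n (S g) = D_long_adj m n g)} = {}"
    by blast
  then show ?thesis
    unfolding reg_const_adj_def by (simp only: image_empty Inf_empty top_ereal_def)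
qed

section \<open>Walks of sign steps\<close>

text \<open>
  The displacement after \<open>k\<close> sign steps that always move coordinate \<open>j\<close> in the direction
  \<open>\<epsilon>\<^sub>j\<close> and move every other coordinate back and forth. After an even number \<open>m\<close> of steps only
  coordinate \<open>j\<close> has moved, by \<open>m\<close> or \<open>-m\<close>, which is the same residue modulo \<open>2m\<close>.
\<close>

definition walk :: "nat \<Rightarrow> nat \<Rightarrow> (nat \<Rightarrow> int) \<Rightarrow> nat \<Rightarrow> int" where
  "walk j k \<epsilon> = (\<lambda>i. if i = j then int k * \<epsilon> i else if odd k then \<epsilon> i else 0)"

text \<open>
  The sign vector of step number \<open>k\<close>, counted from 0. Since it is an involution of the sign
  vectors, each step of a walk with a uniformly random \<open>\<epsilon>\<close> is itself uniformly distributed.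
\<close>

definition walk_step :: "nat \<Rightarrow> nat \<Rightarrow> nat \<Rightarrow> (nat \<Rightarrow> int) \<Rightarrow> nat \<Rightarrow> int" where
  "walk_step n j k \<epsilon> = (\<lambda>i\<in>{1..n}. if i = j \<or> even k then \<epsilon> i else - \<epsilon> i)"

lemma walk_step_in [simp]: "\<epsilon> \<in> signs n \<Longrightarrow> walk_step n j k \<epsilon> \<in> signs n"
  by (auto simp: walk_step_def signs_def PiE_def Pi_def)

lemma walk_step_walk_step [simp]:
  "\<epsilon> \<in> signs n \<Longrightarrow> walk_step n j k (walk_step n j k \<epsilon>) = \<epsilon>"
  by (auto simp: walk_step_def signs_def PiE_def extensional_def fun_eq_iff)

lemma bij_walk_step: "bij_betw (walk_step n j k) (signs n) (signs n)"
  by (rule bij_betw_byWitness[where f' = "walk_step n j k"]) auto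

lemma torus_add_walk_Suc:
  "torus_add m n (torus_add m n x (walk j k \<epsilon>)) (walk_step n j k \<epsilon>) = torus_add m n x (walk j (Suc k) \<epsilon>)"
  by (auto simp: torus_add_def walk_def walk_step_def fun_eq_iff mod_simps algebra_simps)

lemma torus_sub_walk_Suc:
  "torus_sub m n (torus_sub m n x (walk_step n j k \<epsilon>)) (walk j k \<epsilon>) = torus_sub m n x (walk j (Suc k) \<epsilon>)"
  by (auto simp: torus_sub_def walk_def walk_step_def fun_eq_iff mod_simps algebra_simps)

lemma torus_add_walk_0 [simp]: "x \<in> torus m n \<Longrightarrow> torus_add m n x (walk j 0 \<epsilon>) = x"
  by (auto simp: torus_add_def walk_def torus_def fun_eq_iff PiE_def extensional_def Pi_def)

lemma torus_sub_walk_0 [simp]: "x \<in> torus m n \<Longrightarrow> torus_sub m n x (walk j 0 \<epsilon>) = x"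
  by (auto simp: torus_sub_def walk_def torus_def fun_eq_iff PiE_def extensional_def Pi_def)

lemma half_turn_sign:
  fixes a e :: int
  assumes "e \<in> {-1, 1}"
  shows "(a + int m * e) mod (2 * int m) = (a + int m) mod (2 * int m)"
    and "(a - int m * e) mod (2 * int m) = (a - int m) mod (2 * int m)"
  using assms by (auto simp: mod_eq_dvd_iff)

lemma walk_end:
  assumes "even m \<or> n = 1" "j \<in> {1..n}" "\<epsilon> \<in> signs n"
  shows "torus_add m n x (walk j m \<epsilon>) = torus_add m n x (int_scale (int m) (std_basis j))"
    and "torus_sub m n x (walk j m \<epsilon>) = torus_sub m n x (int_scale (int m) (std_basis j))"
proof -
  have "\<epsilon> j \<in> {-1, 1}"
    using assms by (auto simp: signs_def)
  note half_turn_sign[OF this]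
  with assms show "torus_add m n x (walk j m \<epsilon>) = torus_add m n x (int_scale (int m) (std_basis j))"
    "torus_sub m n x (walk j m \<epsilon>) = torus_sub m n x (int_scale (int m) (std_basis j))"
    by (auto simp: torus_add_def torus_sub_def walk_def int_scale_def std_basis_def fun_eq_iff)
qed

lemma sum_along_walk:
  fixes f :: "(nat \<Rightarrow> int) \<Rightarrow> real"
  assumes "even m \<or> n = 1" "j \<in> {1..n}" "\<epsilon> \<in> signs n" "x \<in> torus m n"
  shows "(\<Sum>k<m. f (torus_add m n x (walk j (Suc k) \<epsilon>)) - f (torus_add m n x (walk j k \<epsilon>)))
      = f (torus_add m n x (int_scale (int m) (std_basis j))) - f x"
    and "(\<Sum>k<m. f (torus_sub m n x (walk j (Suc k) \<epsilon>)) - f (torus_sub m n x (walk j k \<epsilon>)))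
      = f (torus_sub m n x (int_scale (int m) (std_basis j))) - f x"
  using walk_end[OF assms(1-3), of x] assms(4)
    sum_lessThan_telescope[of "\<lambda>k. f (torus_add m n x (walk j k \<epsilon>))" m]
    sum_lessThan_telescope[of "\<lambda>k. f (torus_sub m n x (walk j k \<epsilon>))" m]
  by simp_all

section \<open>The upper bound: averaging over walks\<close>

text \<open>
  When \<open>m\<close> is even or \<open>n = 1\<close>, the long difference at \<open>(x, j)\<close> is the sum of the sign
  differences along any of these walks from \<open>x\<close>. Averaging over all \<open>\<epsilon>\<close>, including those with
  \<open>\<epsilon>\<^sub>j = -1\<close>, makes every step uniform on all of \<open>\<Sigma>\<^sub>n\<close>; walks with \<open>\<epsilon>\<^sub>j = 1\<close> only
  would put double weight on half of it and spoil the constant. The factor \<open>m\<close> turns the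
  average over the \<open>m\<close> steps back into a sum.
\<close>

definition walk_average ::
  "nat \<Rightarrow> nat \<Rightarrow> ((nat \<Rightarrow> int) \<times> (nat \<Rightarrow> int) \<Rightarrow> real) \<Rightarrow> (nat \<Rightarrow> int) \<times> nat \<Rightarrow> real" where
  "walk_average m n = average_along (real m) (torus m n \<times> {1..n}) ({..<m} \<times> signs n)
     (\<lambda>(x, j) (k, \<epsilon>). (torus_add m n x (walk j k \<epsilon>), walk_step n j k \<epsilon>))"

text \<open>
  The adjoint of \<open>walk_average\<close>: the sign edge \<open>(y, \<epsilon>)\<close> is step number \<open>k\<close> of the walk in
  direction \<open>j\<close> driven by \<open>walk_step n j k \<epsilon>\<close>, and the start of that walk is recovered by
  subtracting its displacement.
\<close>

definition walk_average_adj ::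
  "nat \<Rightarrow> nat \<Rightarrow> ((nat \<Rightarrow> int) \<times> nat \<Rightarrow> real) \<Rightarrow> (nat \<Rightarrow> int) \<times> (nat \<Rightarrow> int) \<Rightarrow> real" where
  "walk_average_adj m n = average_along (real m) (torus m n \<times> signs n) ({..<m} \<times> {1..n})
     (\<lambda>(y, \<epsilon>) (k, j). (torus_sub m n y (walk j k (walk_step n j k \<epsilon>)), j))"

lemma walk_average_D_sgn:
  assumes m: "1 \<le> m" and "even m \<or> n = 1"
  shows "walk_average m n (D_sgn m n f) = D_long m n f"
proof
  fix \<omega>'
  show "walk_average m n (D_sgn m n f) \<omega>' = D_long m n f \<omega>'"
  proof (cases "\<omega>' \<in> torus m n \<times> {1..n}")
    case False
    then show ?thesis
      by (auto simp: walk_average_def average_along_def D_long_def)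
  next
    case True
    then obtain x j where [simp]: "\<omega>' = (x, j)" and x: "x \<in> torus m n" "j \<in> {1..n}"
      by auto
    have "walk_average m n (D_sgn m n f) \<omega>' = 1 / 2 ^ n * (\<Sum>k<m. \<Sum>\<epsilon>\<in>signs n.
        D_sgn m n f (torus_add m n x (walk j k \<epsilon>), walk_step n j k \<epsilon>))"
      using True m by (simp add: walk_average_def average_along_def sum.cartesian_product split_def)
    also have "\<dots> = 1 / 2 ^ n * (\<Sum>k<m. \<Sum>\<epsilon>\<in>signs n.
        f (torus_add m n x (walk j (Suc k) \<epsilon>)) - f (torus_add m n x (walk j k \<epsilon>)))"
      using m by (simp add: D_sgn_def torus_add_walk_Suc)
    also have "\<dots> = 1 / 2 ^ n * (\<Sum>\<epsilon>\<in>signs n. f (torus_add m n x (int_scale (int m) (std_basis j))) - f x)"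
      using x assms by (subst sum.swap) (simp add: sum_along_walk)
    also have "\<dots> = D_long m n f \<omega>'"
      using x by (simp add: D_long_def)
    finally show ?thesis .
  qed
qed

text \<open>
  For fixed \<open>j\<close> and \<open>k\<close> the substitution \<open>\<epsilon> \<mapsto> walk_step n j k \<epsilon>\<close> makes the two terms of
  \<open>D_sgn\<^sup>*\<close> consecutive points of one walk, run backwards from \<open>x\<close>; the sum over \<open>k\<close> then
  telescopes.
\<close>

lemma D_sgn_adj_walk_average_adj:
  assumes m: "1 \<le> m" and n: "1 \<le> n" and even: "even m \<or> n = 1"
  shows "D_sgn_adj m n (walk_average_adj m n g) = D_long_adj m n g"
proof
  fix x
  show "D_sgn_adj m n (walk_average_adj m n g) x = D_long_adj m n g x"
  proof (cases "x \<in> torus m n")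
    case False
    then show ?thesis
      by (simp add: D_sgn_adj_def D_long_adj_def)
  next
    case True
    let ?g = "\<lambda>y j k \<epsilon>. g (torus_sub m n y (walk j k \<epsilon>), j)"
    have S: "walk_average_adj m n g (y, \<epsilon>) = 1 / real n * (\<Sum>j=1..n. \<Sum>k<m. ?g y j k (walk_step n j k \<epsilon>))"
      if "y \<in> torus m n" "\<epsilon> \<in> signs n" for y \<epsilon>
      using that m
      by (subst sum.swap)
        (simp add: walk_average_adj_def average_along_def sum.cartesian_product split_def)
    have reindex: "(\<Sum>\<epsilon>\<in>signs n. ?g (torus_sub m n x \<epsilon>) j k (walk_step n j k \<epsilon>) - ?g x j k (walk_step n j k \<epsilon>))
        = (\<Sum>\<epsilon>\<in>signs n. ?g x j (Suc k) \<epsilon> - ?g x j k \<epsilon>)" for j k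
    proof -
      have "(\<Sum>\<epsilon>\<in>signs n. ?g (torus_sub m n x \<epsilon>) j k (walk_step n j k \<epsilon>) - ?g x j k (walk_step n j k \<epsilon>))
          = (\<Sum>\<epsilon>\<in>signs n. ?g (torus_sub m n x (walk_step n j k \<epsilon>)) j k (walk_step n j k (walk_step n j k \<epsilon>))
              - ?g x j k (walk_step n j k (walk_step n j k \<epsilon>)))"
        by (rule sum.reindex_bij_betw[OF bij_walk_step, symmetric])
      also have "\<dots> = (\<Sum>\<epsilon>\<in>signs n. ?g x j (Suc k) \<epsilon> - ?g x j k \<epsilon>)"
        by (intro sum.cong) (auto simp: torus_sub_walk_Suc)
      finally show ?thesis .
    qed
    have diff: "walk_average_adj m n g (torus_sub m n x \<epsilon>, \<epsilon>) - walk_average_adj m n g (x, \<epsilon>)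
        = 1 / real n * (\<Sum>j=1..n. \<Sum>k<m.
            ?g (torus_sub m n x \<epsilon>) j k (walk_step n j k \<epsilon>) - ?g x j k (walk_step n j k \<epsilon>))"
      if "\<epsilon> \<in> signs n" for \<epsilon>
      using that True m by (simp add: S sum_subtractf diff_divide_distrib)
    have "D_sgn_adj m n (walk_average_adj m n g) x
        = 1 / 2 ^ n * (1 / real n * (\<Sum>\<epsilon>\<in>signs n. \<Sum>j=1..n. \<Sum>k<m.
            ?g (torus_sub m n x \<epsilon>) j k (walk_step n j k \<epsilon>) - ?g x j k (walk_step n j k \<epsilon>)))"
      using True by (simp only: D_sgn_adj_def restrict_apply' diff sum_distrib_left[symmetric] cong: sum.cong)
    also have "(\<Sum>\<epsilon>\<in>signs n. \<Sum>j=1..n. \<Sum>k<m.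
            ?g (torus_sub m n x \<epsilon>) j k (walk_step n j k \<epsilon>) - ?g x j k (walk_step n j k \<epsilon>))
        = (\<Sum>j=1..n. \<Sum>k<m. \<Sum>\<epsilon>\<in>signs n.
            ?g (torus_sub m n x \<epsilon>) j k (walk_step n j k \<epsilon>) - ?g x j k (walk_step n j k \<epsilon>))"
      by (subst sum.swap) (intro sum.cong refl sum.swap)
    also have "\<dots> = (\<Sum>j=1..n. \<Sum>k<m. \<Sum>\<epsilon>\<in>signs n. ?g x j (Suc k) \<epsilon> - ?g x j k \<epsilon>)"
      unfolding reindex ..
    also have "\<dots> = (\<Sum>j=1..n. \<Sum>\<epsilon>\<in>signs n. \<Sum>k<m. ?g x j (Suc k) \<epsilon> - ?g x j k \<epsilon>)"
      by (intro sum.cong refl sum.swap)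
    also have "\<dots> = (\<Sum>j=1..n. \<Sum>\<epsilon>\<in>signs n.
        g (torus_sub m n x (int_scale (int m) (std_basis j)), j) - g (x, j))"
      using sum_along_walk(2)[OF even _ _ True, where f = "\<lambda>y. g (y, _)"]
      by (intro sum.cong) auto
    also have "1 / 2 ^ n * (1 / real n * \<dots>) = D_long_adj m n g x"
      using True by (simp add: D_long_adj_def sum_distrib_left[symmetric])
    finally show ?thesis .
  qed
qed

text \<open>
  For fixed \<open>j\<close> and \<open>k\<close>, the map sending \<open>(x, \<epsilon>)\<close> to the corresponding sign edge is a translation in
  \<open>x\<close> for each \<open>\<epsilon>\<close>, followed by the involution in \<open>\<epsilon>\<close>; so it permutes \<open>G \<times> \<Sigma>\<^sub>n\<close>.
\<close>

lemma reg_norm_walk_average_le: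
  assumes m: "1 \<le> m" and n: "1 \<le> n" and r: "1 \<le> r"
  shows "reg_norm r (torus m n \<times> signs n) (torus m n \<times> {1..n}) (walk_average m n) \<le> ereal (real m)"
proof (rule reg_norm_le_of_measure_preserving)
  let ?\<phi> = "\<lambda>(x, j) (k, \<epsilon>). (torus_add m n x (walk j k \<epsilon>), walk_step n j k \<epsilon>)"
  let ?B = "{..<m} \<times> signs n" and ?\<Omega>' = "torus m n \<times> {1..n}" and ?\<Omega> = "torus m n \<times> signs n"
  show "walk_average m n f \<omega>' = real m * ((\<Sum>b\<in>?B. f (?\<phi> \<omega>' b)) / real (card ?B))"
    if "\<omega>' \<in> ?\<Omega>'" for f \<omega>'
    using that unfolding walk_average_def average_along_def by simp
  fix u :: "(nat \<Rightarrow> int) \<times> (nat \<Rightarrow> int) \<Rightarrow> real"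
  have inner: "(\<Sum>x\<in>torus m n. \<Sum>\<epsilon>\<in>signs n. u (torus_add m n x (walk j k \<epsilon>), walk_step n j k \<epsilon>))
      = (\<Sum>\<omega>\<in>?\<Omega>. u \<omega>)" for j k
  proof -
    have "(\<Sum>x\<in>torus m n. \<Sum>\<epsilon>\<in>signs n. u (torus_add m n x (walk j k \<epsilon>), walk_step n j k \<epsilon>))
        = (\<Sum>\<epsilon>\<in>signs n. \<Sum>x\<in>torus m n. u (torus_add m n x (walk j k \<epsilon>), walk_step n j k \<epsilon>))"
      by (rule sum.swap)
    also have "\<dots> = (\<Sum>\<epsilon>\<in>signs n. \<Sum>x\<in>torus m n. u (x, walk_step n j k \<epsilon>))"
      by (intro sum.cong refl sum.reindex_bij_betw[OF bij_torus_add[OF m], where g = "\<lambda>x. u (x, _)"])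
    also have "\<dots> = (\<Sum>\<epsilon>\<in>signs n. \<Sum>x\<in>torus m n. u (x, \<epsilon>))"
      by (rule sum.reindex_bij_betw[OF bij_walk_step])
    also have "\<dots> = (\<Sum>\<omega>\<in>?\<Omega>. u \<omega>)"
      by (subst sum.swap) (simp add: sum.cartesian_product)
    finally show ?thesis .
  qed
  have "(\<Sum>\<omega>'\<in>?\<Omega>'. \<Sum>b\<in>?B. u (?\<phi> \<omega>' b))
      = (\<Sum>x\<in>torus m n. \<Sum>j=1..n. \<Sum>k<m. \<Sum>\<epsilon>\<in>signs n. u (torus_add m n x (walk j k \<epsilon>), walk_step n j k \<epsilon>))"
    by (simp add: sum.cartesian_product')
  also have "\<dots> = (\<Sum>j=1..n. \<Sum>k<m. \<Sum>x\<in>torus m n. \<Sum>\<epsilon>\<in>signs n. u (torus_add m n x (walk j k \<epsilon>), walk_step n j k \<epsilon>))"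
    by (subst sum.swap) (intro sum.cong refl sum.swap)
  also have "\<dots> = real n * (real m * (\<Sum>\<omega>\<in>?\<Omega>. u \<omega>))"
    unfolding inner by simp
  finally show "(\<Sum>\<omega>'\<in>?\<Omega>'. (\<Sum>b\<in>?B. u (?\<phi> \<omega>' b)) / real (card ?B)) / real (card ?\<Omega>')
      = (\<Sum>\<omega>\<in>?\<Omega>. u \<omega>) / real (card ?\<Omega>)"
    using m n card_torus_pos[OF m, of n]
    by (simp add: sum_divide_distrib[symmetric] divide_simps)
qed (use m n r in \<open>auto simp: lessThan_empty_iff\<close>)

lemma reg_norm_walk_average_adj_le:
  assumes m: "1 \<le> m" and n: "1 \<le> n" and r: "1 \<le> r"
  shows "reg_norm r (torus m n \<times> {1..n}) (torus m n \<times> signs n) (walk_average_adj m n) \<le> ereal (real m)"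
proof (rule reg_norm_le_of_measure_preserving)
  let ?\<phi> = "\<lambda>(y, \<epsilon>) (k, j). (torus_sub m n y (walk j k (walk_step n j k \<epsilon>)), j)"
  let ?B = "{..<m} \<times> {1..n}" and ?\<Omega> = "torus m n \<times> {1..n}" and ?\<Omega>' = "torus m n \<times> signs n"
  show "walk_average_adj m n f \<omega>' = real m * ((\<Sum>b\<in>?B. f (?\<phi> \<omega>' b)) / real (card ?B))"
    if "\<omega>' \<in> ?\<Omega>'" for f \<omega>'
    using that unfolding walk_average_adj_def average_along_def by simp
  fix u :: "(nat \<Rightarrow> int) \<times> nat \<Rightarrow> real"
  have inner: "(\<Sum>y\<in>torus m n. \<Sum>j=1..n. u (torus_sub m n y (walk j k (walk_step n j k \<epsilon>)), j))
      = (\<Sum>\<omega>\<in>?\<Omega>. u \<omega>)" for \<epsilon> k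
  proof -
    have "(\<Sum>y\<in>torus m n. \<Sum>j=1..n. u (torus_sub m n y (walk j k (walk_step n j k \<epsilon>)), j))
        = (\<Sum>j=1..n. \<Sum>y\<in>torus m n. u (torus_sub m n y (walk j k (walk_step n j k \<epsilon>)), j))"
      by (rule sum.swap)
    also have "\<dots> = (\<Sum>j=1..n. \<Sum>y\<in>torus m n. u (y, j))"
      by (intro sum.cong refl sum.reindex_bij_betw[OF bij_torus_sub[OF m], where g = "\<lambda>y. u (y, _)"])
    also have "\<dots> = (\<Sum>\<omega>\<in>?\<Omega>. u \<omega>)"
      by (subst sum.swap) (simp add: sum.cartesian_product)
    finally show ?thesis .
  qed
  have "(\<Sum>\<omega>'\<in>?\<Omega>'. \<Sum>b\<in>?B. u (?\<phi> \<omega>' b))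
      = (\<Sum>y\<in>torus m n. \<Sum>\<epsilon>\<in>signs n. \<Sum>k<m. \<Sum>j=1..n. u (torus_sub m n y (walk j k (walk_step n j k \<epsilon>)), j))"
    by (simp add: sum.cartesian_product')
  also have "\<dots> = (\<Sum>\<epsilon>\<in>signs n. \<Sum>k<m. \<Sum>y\<in>torus m n. \<Sum>j=1..n. u (torus_sub m n y (walk j k (walk_step n j k \<epsilon>)), j))"
    by (subst sum.swap) (intro sum.cong refl sum.swap)
  also have "\<dots> = 2 ^ n * (real m * (\<Sum>\<omega>\<in>?\<Omega>. u \<omega>))"
    unfolding inner by simp
  finally show "(\<Sum>\<omega>'\<in>?\<Omega>'. (\<Sum>b\<in>?B. u (?\<phi> \<omega>' b)) / real (card ?B)) / real (card ?\<Omega>')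
      = (\<Sum>\<omega>\<in>?\<Omega>. u \<omega>) / real (card ?\<Omega>)"
    using m n card_torus_pos[OF m, of n]
    by (simp add: sum_divide_distrib[symmetric] divide_simps)
qed (use m n r in \<open>auto simp: lessThan_empty_iff\<close>)

lemma reg_const_le:
  assumes "1 \<le> m" "1 \<le> n" "1 \<le> r" "even m \<or> n = 1"
  shows "reg_const r n m \<le> ereal (real m)"
proof -
  have "linear_operator (torus m n \<times> signs n) (torus m n \<times> {1..n}) (walk_average m n)"
    unfolding walk_average_def using assms by (intro linear_operator_average_along) auto
  then have "reg_const r n m
      \<le> reg_norm r (torus m n \<times> signs n) (torus m n \<times> {1..n}) (walk_average m n)"
    unfolding reg_const_def using walk_average_D_sgn[OF assms(1,4)] by (intro INF_lower) simp
  then show ?thesis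
    using reg_norm_walk_average_le[OF assms(1-3)] by (rule order_trans)
qed

lemma reg_const_adj_le:
  assumes "1 \<le> m" "1 \<le> n" "1 \<le> r" "even m \<or> n = 1"
  shows "reg_const_adj r n m \<le> ereal (real m)"
proof -
  have "linear_operator (torus m n \<times> {1..n}) (torus m n \<times> signs n) (walk_average_adj m n)"
    unfolding walk_average_adj_def using assms by (intro linear_operator_average_along) auto
  then have "reg_const_adj r n m
      \<le> reg_norm r (torus m n \<times> {1..n}) (torus m n \<times> signs n) (walk_average_adj m n)"
    unfolding reg_const_adj_def using D_sgn_adj_walk_average_adj[OF assms(1,2,4)] by (intro INF_lower) simp
  then show ?thesis
    using reg_norm_walk_average_adj_le[OF assms(1-3)] by (rule order_trans)
qed

section \<open>The two constants\<close>

lemma conj_exponent_ge_1: "1 \<le> p \<Longrightarrow> 1 \<le> conj_exponent p"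
  by (simp add: conj_exponent_def)

theorem theorem1p3:
  fixes p :: real
  assumes "1 \<le> p"
  shows "(\<forall>n\<ge>1. \<forall>m\<ge>1. even m \<longrightarrow>
            reg_const (ereal p) n m = ereal (real m) \<and>
            reg_const_adj (conj_exponent p) n m = ereal (real m)) \<and>
         (\<forall>m\<ge>1. reg_const (ereal p) 1 m = ereal (real m) \<and>
            reg_const_adj (conj_exponent p) 1 m = ereal (real m)) \<and>
         (\<forall>n\<ge>2. \<forall>m\<ge>1. odd m \<longrightarrow>
            reg_const (ereal p) n m = \<infinity> \<and>
            reg_const_adj (conj_exponent p) n m = \<infinity>)"
proof -
  have r: "1 \<le> ereal p" "1 \<le> conj_exponent p"
    using assms by (simp_all add: conj_exponent_ge_1)
  have "reg_const (ereal p) n m = ereal (real m) \<and> reg_const_adj (conj_exponent p) n m = ereal (real m)"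
    if "1 \<le> n" "1 \<le> m" "even m \<or> n = 1" for n m
    using that r
    by (intro conjI antisym reg_const_le reg_const_ge reg_const_adj_le reg_const_adj_ge)
  then show ?thesis
    by (simp add: reg_const_eq_infinity reg_const_adj_eq_infinity)
qed

end
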